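(* Let $g$ be a positive integer, let $\mathcal{A}$ be a finite nonempty $g$-thin Sidon set of integers, and let $T$ be a positive integer. For $0\le s\le g$ let $D_s$ be the set of integers $r\in[1,T)$ that have exactly $s$ representations as $r=a-b$ with $(a,b)\in\mathcal{A}^2$. Then \[ \operatorname{diam}(\mathcal{A})=\frac{|\mathcal{A}|^2T^2}{gT(T-1)+|\mathcal{A}|T-\bigl(2S_g(\mathcal{A},T)+V(\mathcal{A},T)\bigr)}-T, \] where $A_i^{(T)}=|\mathcal{A}\cap[i-T,i)|$, \[ S_g(\mathcal{A},T)=\sum_{s=0}^{g-1}\sum_{r\in D_s}(g-s)(T-r), \] and \[ V(\mathcal{A},T)=\sum_{i=\min(\mathcal{A})+1}^{T+\max(\mathcal{A})}\left(A_i^{(T)}-\frac{|\mathcal{A}|T}{T+\operatorname{diam}(\mathcal{A})}\right)^2. \]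
   Context: A set $\mathcal{A}$ of integers is a $g$-thin Sidon set if for every integer $d$, the number of pairs $(a,b)\in\mathcal{A}^2$ with $a\ne b$ and $a-b=d$ is at most $g$. For a finite set $\mathcal{A}$, $\operatorname{diam}(\mathcal{A})=\max\mathcal{A}-\min\mathcal{A}$. All intervals are intervals of integers, e.g. $[i-T,i)=\{i-T,\dots,i-1\}$. *)

theory Defs
  imports Complex_Main
begin

(* The finiteness conjunct matters only for infinite A, where card would be 0. *)
definition thin_Sidon :: "nat \<Rightarrow> int set \<Rightarrow> bool" where
  "thin_Sidon g A \<longleftrightarrow>
     (\<forall>d::int. finite {(a, b). a \<in> A \<and> b \<in> A \<and> a \<noteq> b \<and> a - b = d} \<and>
               card {(a, b). a \<in> A \<and> b \<in> A \<and> a \<noteq> b \<and> a - b = d} \<le> g)"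

definition diam :: "int set \<Rightarrow> int" where
  "diam A = Max A - Min A"

definition D_set :: "int set \<Rightarrow> nat \<Rightarrow> nat \<Rightarrow> int set" where
  "D_set A T s =
     {r \<in> {1..<int T}. card {(a, b). a \<in> A \<and> b \<in> A \<and> r = a - b} = s}"

definition window_count :: "int set \<Rightarrow> nat \<Rightarrow> int \<Rightarrow> nat" where
  "window_count A T i = card (A \<inter> {i - int T..<i})"

definition S_sum :: "nat \<Rightarrow> int set \<Rightarrow> nat \<Rightarrow> real" where
  "S_sum g A T =
     (\<Sum>s = 0..<g. \<Sum>r \<in> D_set A T s. (real g - real s) * (real T - real_of_int r))"

definition V_sum :: "int set \<Rightarrow> nat \<Rightarrow> real" where
  "V_sum A T =
     (\<Sum>i = Min A + 1..int T + Max A.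
        (real (window_count A T i) -
           real (card A) * real T / (real T + real_of_int (diam A)))\<^sup>2)"

end

theory Submission
  imports Defs
begin

text \<open>Put \<open>n = |A|\<close> and \<open>N = T + diam A\<close>, the number of windows. Counting incidences gives
  \<open>\<Sum> A\<^sub>i = n T\<close>, and counting pairs inside windows gives
  \<open>\<Sum> A\<^sub>i\<^sup>2 = \<Sum> (max 0 (T - |a - b|)) = n T + 2 \<Sum> R(r) (T - r)\<close>, where \<open>R(r)\<close> is the number of
  representations of \<open>r\<close>; since \<open>R(r) \<le> g\<close>, this is \<open>n T + g T (T - 1) - 2 S\<close>. As \<open>V\<close> is the sum of
  squared deviations of the \<open>A\<^sub>i\<close> from their mean, it equals \<open>\<Sum> A\<^sub>i\<^sup>2 - n\<^sup>2 T\<^sup>2 / N\<close>, so the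
  denominator of the formula is \<open>n\<^sup>2 T\<^sup>2 / N\<close>.\<close>

definition rep_count :: "int set \<Rightarrow> int \<Rightarrow> nat" where
  "rep_count A r = card {(a, b). a \<in> A \<and> b \<in> A \<and> r = a - b}"

text \<open>The window \<open>[i - T, i)\<close> contains \<open>a\<close> exactly when
  \<open>i\<close> lies in \<open>[a + 1, a + T]\<close>. Written as a sum of indicators, the count
  can be double counted.\<close>

lemma window_count_eq_sum:
  assumes "finite A"
  shows "real (window_count A T i) = (\<Sum>a\<in>A. of_bool (i \<in> {a+1..a+int T}))"
proof -
  have "A \<inter> {i - int T..<i} = A \<inter> {a. i \<in> {a+1..a+int T}}" by auto
  then show ?thesis using assms by (simp add: window_count_def)
qed

text \<open>Restricting \<open>i\<close> to this range loses no incidence: every window that meets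
  \<open>A\<close> is indexed in it.\<close>

lemma windows_containing_subset:
  assumes "finite A" "a \<in> A"
  shows "{a+1..a+int T} \<subseteq> {Min A + 1..int T + Max A}"
  using Min_le[OF assms] Max_ge[OF assms] by auto

lemma sum_window_count:
  assumes "finite A"
  shows "(\<Sum>i = Min A + 1..int T + Max A. real (window_count A T i)) = real (card A) * real T"
proof -
  have "(\<Sum>i = Min A + 1..int T + Max A. real (window_count A T i))
      = (\<Sum>a\<in>A. \<Sum>i = Min A + 1..int T + Max A. of_bool (i \<in> {a+1..a+int T}))"
    unfolding window_count_eq_sum[OF assms] by (rule sum.swap)
  also have "\<dots> = (\<Sum>a\<in>A. real T)"
  proof (rule sum.cong[OF refl])
    fix a assume "a \<in> A"
    then have "{Min A + 1..int T + Max A} \<inter> {i. i \<in> {a+1..a+int T}} = {a+1..a+int T}"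
      using windows_containing_subset[OF assms] by blast
    then show "(\<Sum>i = Min A + 1..int T + Max A. of_bool (i \<in> {a+1..a+int T})) = real T"
      by (subst sum_of_bool_eq) simp_all
  qed
  finally show ?thesis by simp
qed

text \<open>The squared sum of indicators expands over pairs \<open>(a, b)\<close>, each counted
  once for every window containing both points.\<close>

lemma sum_window_count_square:
  assumes "finite A"
  shows "(\<Sum>i = Min A + 1..int T + Max A. (real (window_count A T i))\<^sup>2)
    = (\<Sum>(a, b)\<in>A \<times> A. max 0 (real T - real_of_int \<bar>a - b\<bar>))"
proof -
  let ?I = "{Min A + 1..int T + Max A}"
  let ?W = "\<lambda>a. {a+1..a+int T}"
  have "(\<Sum>i\<in>?I. (real (window_count A T i))\<^sup>2)
      = (\<Sum>i\<in>?I. \<Sum>(a, b)\<in>A \<times> A. of_bool (i \<in> ?W a \<inter> ?W b))"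
    unfolding window_count_eq_sum[OF assms] power2_eq_square sum_product sum.cartesian_product
    by (simp only: of_bool_conj Int_iff)
  also have "\<dots> = (\<Sum>(a, b)\<in>A \<times> A. \<Sum>i\<in>?I. of_bool (i \<in> ?W a \<inter> ?W b))"
    by (subst sum.swap) (simp only: case_prod_unfold)
  also have "\<dots> = (\<Sum>(a, b)\<in>A \<times> A. max 0 (real T - real_of_int \<bar>a - b\<bar>))"
  proof (rule sum.cong[OF refl], clarify)
    fix a b assume "a \<in> A" "b \<in> A"
    \<comment> \<open>Two integer intervals of length \<open>T\<close>, shifted by
      \<open>\<bar>a - b\<bar>\<close>, share \<open>T - \<bar>a - b\<bar>\<close> points, or none
      if this is negative.\<close>
    then have "?I \<inter> {i. i \<in> ?W a \<inter> ?W b} = {max a b + 1..min a b + int T}"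
      using windows_containing_subset[OF assms, of a T] by auto
    then show "(\<Sum>i\<in>?I. of_bool (i \<in> ?W a \<inter> ?W b)) = max 0 (real T - real_of_int \<bar>a - b\<bar>)"
      by (subst sum_of_bool_eq) simp_all
  qed
  finally show ?thesis .
qed

lemma sum_rep_count:
  fixes f :: "int \<Rightarrow> real"
  assumes "finite A" "finite R"
  shows "(\<Sum>r\<in>R. real (rep_count A r) * f r) = (\<Sum>(a, b)\<in>A \<times> A. of_bool (a - b \<in> R) * f (a - b))"
proof -
  have "(\<Sum>(a, b)\<in>A \<times> A. of_bool (a - b \<in> R) * f (a - b))
      = (\<Sum>(a, b)\<in>A \<times> A. \<Sum>r\<in>R. of_bool (r = a - b) * f r)"
    using assms by (intro sum.cong) (auto simp: of_bool_def if_distrib[of "\<lambda>x. x * _"] cong: if_cong)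
  also have "\<dots> = (\<Sum>r\<in>R. \<Sum>(a, b)\<in>A \<times> A. of_bool (r = a - b) * f r)"
    by (simp only: case_prod_unfold) (rule sum.swap)
  also have "\<dots> = (\<Sum>r\<in>R. real (rep_count A r) * f r)"
  proof (rule sum.cong[OF refl])
    fix r
    have "{(a, b). a \<in> A \<and> b \<in> A \<and> r = a - b} = (A \<times> A) \<inter> {p. r = fst p - snd p}" by auto
    then show "(\<Sum>(a, b)\<in>A \<times> A. of_bool (r = a - b) * f r) = real (rep_count A r) * f r"
      using assms by (simp add: rep_count_def case_prod_unfold flip: sum_distrib_right)
  qed
  finally show ?thesis by simp
qed

lemma sum_overlap_eq:
  assumes "finite A"
  shows "(\<Sum>(a, b)\<in>A \<times> A. max 0 (real T - real_of_int \<bar>a - b\<bar>))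
    = real (card A) * real T + 2 * (\<Sum>r = 1..<int T. real (rep_count A r) * (real T - real_of_int r))"
proof -
  \<comment> \<open>The share of the pairs with \<open>0 < a - b < T\<close>. The diagonal gives
    \<open>T\<close> per element, the pairs with \<open>a < b\<close> follow by symmetry, and
    differences of size at least \<open>T\<close> contribute 0.\<close>
  let ?h = "\<lambda>a b. of_bool (a - b \<in> {1..<int T}) * (real T - real_of_int (a - b))"
  have swap: "(\<Sum>(a, b)\<in>A \<times> A. ?h b a) = (\<Sum>(a, b)\<in>A \<times> A. ?h a b)"
    unfolding sum.cartesian_product[symmetric] by (rule sum.swap)
  have "(\<Sum>(a, b)\<in>A \<times> A. max 0 (real T - real_of_int \<bar>a - b\<bar>))
      = (\<Sum>(a, b)\<in>A \<times> A. of_bool (a = b) * real T + ?h a b + ?h b a)"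
    by (intro sum.cong) (auto simp: of_bool_def)
  also have "\<dots> = (\<Sum>(a, b)\<in>A \<times> A. of_bool (a = b) * real T)
      + (\<Sum>(a, b)\<in>A \<times> A. ?h a b) + (\<Sum>(a, b)\<in>A \<times> A. ?h b a)"
    by (simp only: case_prod_unfold sum.distrib)
  also have "(\<Sum>(a, b)\<in>A \<times> A. of_bool (a = b) * real T) = real (card A) * real T"
    unfolding sum.cartesian_product[symmetric] using assms
    by (simp add: of_bool_def if_distrib[of "\<lambda>x. x * _"] cong: if_cong)
  finally show ?thesis
    unfolding swap using sum_rep_count[OF assms, of "{1..<int T}" "\<lambda>r. real T - real_of_int r"] by simp
qed

lemma rep_count_le:
  assumes "thin_Sidon g A" "r \<noteq> 0"
  shows "rep_count A r \<le> g"
proof -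
  have "{(a, b). a \<in> A \<and> b \<in> A \<and> r = a - b} = {(a, b). a \<in> A \<and> b \<in> A \<and> a \<noteq> b \<and> a - b = r}"
    using assms(2) by auto
  then show ?thesis using assms(1) by (simp add: thin_Sidon_def rep_count_def)
qed

text \<open>The sets \<open>D_set A T s\<close> with \<open>s \<le> g\<close> are the fibres of
  \<open>rep_count A\<close> and partition \<open>[1, T)\<close>, because no count exceeds
  \<open>g\<close> there.\<close>

lemma S_sum_eq:
  assumes "thin_Sidon g A"
  shows "S_sum g A T = (\<Sum>r = 1..<int T. (real g - real (rep_count A r)) * (real T - real_of_int r))"
proof -
  let ?f = "\<lambda>r. (real g - real (rep_count A r)) * (real T - real_of_int r)"
  have D: "D_set A T s = {r \<in> {1..<int T}. rep_count A r = s}" for s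
    by (simp add: D_set_def rep_count_def)
  have "S_sum g A T = (\<Sum>s = 0..<g. \<Sum>r\<in>D_set A T s. ?f r)"
    unfolding S_sum_def by (intro sum.cong) (auto simp: D)
  \<comment> \<open>Adding \<open>s = g\<close> costs nothing, as the weight \<open>g - s\<close>
    vanishes, and makes the fibres cover \<open>[1, T)\<close>.\<close>
  also have "\<dots> = (\<Sum>s = 0..g. \<Sum>r\<in>D_set A T s. ?f r)"
    by (simp add: D atLeastLessThanSuc_atLeastAtMost[symmetric])
  also have "\<dots> = (\<Sum>r = 1..<int T. ?f r)"
    unfolding D using rep_count_le[OF assms] by (intro sum.group) auto
  finally show ?thesis .
qed

lemma sum_T_minus:
  "2 * (\<Sum>r = 1..<int T. real T - real_of_int r) = real T * (real T - 1)"
proof (induction T)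
  case (Suc T)
  have "{1..<int (Suc T)} = {1..int T}" by auto
  \<comment> \<open>The new endpoint \<open>r = T\<close> contributes 0.\<close>
  moreover have "(\<Sum>r = 1..int T. real T - real_of_int r) = (\<Sum>r = 1..<int T. real T - real_of_int r)"
    by (intro sum.mono_neutral_right) auto
  moreover have "(\<Sum>r = 1..int T. real (Suc T) - real_of_int r) 
      = (\<Sum>r = 1..int T. real T - real_of_int r) + real T"
    by (simp add: sum.distrib sum_subtractf algebra_simps)
  ultimately show ?case using Suc.IH by (simp add: algebra_simps)
qed simp

text \<open>\<open>S_sum\<close> measures the deficit from the extreme case where every
  \<open>r\<close> in \<open>[1, T)\<close> has \<open>g\<close> representations.\<close>

lemma sum_window_count_square_eq:
  assumes "finite A" "thin_Sidon g A"
  shows "(\<Sum>i = Min A + 1..int T + Max A. (real (window_count A T i))\<^sup>2)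
    = real g * real T * (real T - 1) + real (card A) * real T - 2 * S_sum g A T"
proof -
  have "S_sum g A T = real g * (\<Sum>r = 1..<int T. real T - real_of_int r)
      - (\<Sum>r = 1..<int T. real (rep_count A r) * (real T - real_of_int r))"
    unfolding S_sum_eq[OF assms(2)] sum_distrib_left sum_subtractf[symmetric]
    by (simp only: left_diff_distrib)
  moreover have "real g * (2 * (\<Sum>r = 1..<int T. real T - real_of_int r)) = real g * real T * (real T - 1)"
    unfolding sum_T_minus by simp
  ultimately show ?thesis
    unfolding sum_window_count_square[OF assms(1)] sum_overlap_eq[OF assms(1)] by linarith
qed

text \<open>The variance identity: with \<open>m\<close> the mean, the cross term is
  \<open>-2 * card I * m\<^sup>2\<close>, which leaves \<open>- card I * m\<^sup>2\<close> in
  total.\<close>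

lemma sum_square_deviation:
  fixes x :: "'a \<Rightarrow> real"
  assumes "finite I" "I \<noteq> {}"
  shows "(\<Sum>i\<in>I. (x i - sum x I / real (card I))\<^sup>2) = (\<Sum>i\<in>I. (x i)\<^sup>2) - (sum x I)\<^sup>2 / real (card I)"
proof -
  define m where "m = sum x I / real (card I)"
  have N: "real (card I) > 0" using assms by (simp add: card_gt_0_iff)
  have "(\<Sum>i\<in>I. (x i - m)\<^sup>2) = (\<Sum>i\<in>I. (x i)\<^sup>2) - 2 * m * sum x I + real (card I) * m\<^sup>2"
    unfolding sum_distrib_left by (simp add: power2_diff sum.distrib sum_subtractf mult_ac)
  also have "\<dots> = (\<Sum>i\<in>I. (x i)\<^sup>2) - (sum x I)\<^sup>2 / real (card I)"
    using N by (simp add: m_def power2_eq_square field_simps)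
  finally show ?thesis by (simp only: m_def)
qed

theorem theorem4:
  fixes g T :: nat and A :: "int set"
  assumes "g \<ge> 1"
    and "finite A"
    and "A \<noteq> {}"
    and "thin_Sidon g A"
    and "T \<ge> 1"
  shows "real_of_int (diam A) =
    (real (card A))\<^sup>2 * (real T)\<^sup>2 /
      (real g * real T * (real T - 1) + real (card A) * real T
        - (2 * S_sum g A T + V_sum A T))
    - real T"
proof -
  let ?I = "{Min A + 1..int T + Max A}"
  let ?N = "real T + real_of_int (diam A)"
  have le: "Min A \<le> Max A" using assms(2,3) by simp
  then have card: "real (card ?I) = ?N" by (simp add: diam_def)
  have N: "?N > 0" using le assms(5) by (simp add: diam_def)
  have n: "real (card A) > 0" "real T > 0" using assms by (auto simp: card_gt_0_iff)
  have "V_sum A T = (\<Sum>i\<in>?I. (real (window_count A T i))\<^sup>2) - (real (card A) * real T)\<^sup>2 / ?N"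
    using sum_square_deviation[of ?I "\<lambda>i. real (window_count A T i)"] le assms(5)
    unfolding V_sum_def card sum_window_count[OF assms(2)] by simp
  then have "real g * real T * (real T - 1) + real (card A) * real T - (2 * S_sum g A T + V_sum A T)
      = (real (card A))\<^sup>2 * (real T)\<^sup>2 / ?N"
    unfolding sum_window_count_square_eq[OF assms(2,4)] by (simp add: power_mult_distrib)
  \<comment> \<open>Since \<open>card A\<close>, \<open>T\<close> and \<open>?N\<close> are
    positive, the quotient is \<open>?N\<close>, and subtracting \<open>T\<close> leaves
    \<open>diam A\<close>.\<close>
  then show ?thesis using N n by simp
qed

end
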